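(* Let $m\ge1$, $T\subseteq\{0,\ldots,m-1\}$, let $W\ge1$ be the machine-word width and $n=\lceil m/W\rceil$. Consider the packed scalar implementation of Frobenius-factorized reduction modulo $g=x^m+\sum_{t\in T}x^t\in\mathbb{F}_2[x]$ described in the context. For $U\ne0$, set $$a_k=\left\lceil\frac{m-2^k\Delta_{\min}}{W}\right\rceil\qquad(0\le k<r).$$ The useful feedback-word support and the shifted-word contributions traversed by the scalar stage loops are, respectively, $$\widehat B_{\mathrm{fb}}=\sum_{t\in T}\sum_{\substack{k\ge0\\2^k\Delta_t<m}}\left\lceil\frac{m-2^k\Delta_t}{W}\right\rceil,$$ $$B_{\mathrm{fb}}^{\mathrm{loop}}=\sum_{k=0}^{r-1}\sum_{t\in T_k}\min\left\{a_k,\,n-\left\lfloor\frac{2^k\Delta_t}{W}\right\rfloor\right\},$$ and the number of destination words touched by the low-assembly shifts is $$B_V=\sum_{t\in T}\left(n-\left\lfloor\frac{t}{W}\right\rfloor\right).$$ They satisfy $$\widehat B_{\mathrm{fb}}\le B_{\mathrm{fb}}^{\mathrm{loop}}\le\widehat B_{\mathrm{fb}}+S_{\mathrm{fb}}.$$ Moreover, $$\sum_{k=0}^{r-1}a_k\le B_{\mathrm{fb}}^{\mathrm{loop}}.$$ An in-place scalar implementation makes one $n$-word high-part extraction, traverses $a_k$ destination words at feedback stage $k$, and makes one $n$-word final assembly pass, in addition to the $B_{\mathrm{fb}}^{\mathrm{loop}}+B_V$ shifted contributions.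
   Context: For $t\in T$ put $\Delta_t=m-t$. For $d\ge 0$, $N^d$ is the truncated right shift on $\mathbb{F}_2^m$: $(N^dy)_i=y_{i+d}$ if $0\le i<m-d$ and $(N^dy)_i=0$ if $m-d\le i<m$; $N^d=0$ for $d\ge m$. Put $U=\sum_{t\in T}N^{\Delta_t}$ and $V(Y)=\sum_{t\in T}(x^tY\bmod x^m)$. When $U\neq0$, $\Delta_{\min}=\min\{\Delta_t:t\in T\}$ and $r=\lceil\log_2(m/\Delta_{\min})\rceil$. For $k\ge0$, $T_k=\{t\in T:2^k\Delta_t<m\}$, and $S_{\mathrm{fb}}=\sum_{k=0}^{r-1}|T_k|$. Frobenius-factorized reduction on input $A=L+x^mH$ ($\deg L,\deg H<m$): set $Y\leftarrow H$; for $k=0,\ldots,r-1$ replace $Y$ by $Y+\sum_{t\in T_k}N^{2^k\Delta_t}Y$ (all shifts reading the same stage input); return $L+V(Y)$ (final low-part assembly). Packed representation: a degree-below-$m$ polynomial is stored in $n$ words of $W$ bits, coefficient $i$ being bit $i\bmod W$ of word $\lfloor i/W\rfloor$, with zero padding above. Counts are of destination-word contributions (pairs of a shift and a destination word), not instructions. The useful feedback-word support counts, over all active pairs $(k,t)$ with shift $d=2^k\Delta_t<m$, the destination words meeting the coefficient positions $0,\ldots,m-d-1$ affected by that shift. The scalar loop of stage $k$ traverses the contiguous range of destination words, starting at word $0$, spanned by the union of all positions affected by active shifts of the stage; for each active shift $d=2^k\Delta_t$ it visits a destination word $w$ in this range only if the source-word index $w+\lfloor d/W\rfloor$ is below the end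 $n$ of the state. The low-assembly shift by $t$ affects the coefficient positions $t,\ldots,m-1$. *)

theory Defs
  imports Complex_Main "HOL-Library.Word" "HOL-Library.Z2"
    "HOL-Computational_Algebra.Polynomial"
begin

section \<open>Frobenius-factorized reduction over the two-element field\<close>

text \<open>
  The field with two elements is the type \<open>bit\<close> of \<^theory>\<open>HOL-Library.Z2\<close>. Vectors of length
  \<open>m\<close> are identified with polynomials of degree below \<open>m\<close>. Throughout, \<open>T\<close> is a subset of
  \<open>{..<m}\<close>, so the natural-number subtraction in \<open>\<Delta>\<close> is exact and \<open>\<Delta> m t \<ge> 1\<close>.
\<close>

definition \<Delta> :: "nat \<Rightarrow> nat \<Rightarrow> nat" where
  "\<Delta> m t = m - t"

text \<open>For \<open>d \<ge> m\<close> the sum below is empty, so the shift is the zero map.\<close>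

definition rshift :: "nat \<Rightarrow> nat \<Rightarrow> bit poly \<Rightarrow> bit poly" where
  "rshift m d y = (\<Sum>i<m - d. monom (coeff y (i + d)) i)"

text \<open>
  \<open>rshift m d\<close> only reads coefficients below \<open>m\<close>, so \<open>U m T\<close> is the zero function on all
  polynomials iff it is the zero operator on vectors of length \<open>m\<close>.
\<close>

definition U :: "nat \<Rightarrow> nat set \<Rightarrow> bit poly \<Rightarrow> bit poly" where
  "U m T = (\<lambda>y. \<Sum>t\<in>T. rshift m (\<Delta> m t) y)"

definition V :: "nat \<Rightarrow> nat set \<Rightarrow> bit poly \<Rightarrow> bit poly" where
  "V m T Y = (\<Sum>t\<in>T. (monom 1 t * Y) mod monom 1 m)"

definition \<Delta>min :: "nat \<Rightarrow> nat set \<Rightarrow> nat" where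
  "\<Delta>min m T = Min (\<Delta> m ` T)"

text \<open>Only meaningful when \<open>U m T\<close> is nonzero; then \<open>0 < \<Delta>min m T < m\<close>.\<close>

definition stages :: "nat \<Rightarrow> nat set \<Rightarrow> nat" where
  "stages m T = nat \<lceil>log 2 (real m / real (\<Delta>min m T))\<rceil>"

definition Tk :: "nat \<Rightarrow> nat set \<Rightarrow> nat \<Rightarrow> nat set" where
  "Tk m T k = {t \<in> T. 2 ^ k * \<Delta> m t < m}"

definition S_fb :: "nat \<Rightarrow> nat set \<Rightarrow> nat" where
  "S_fb m T = (\<Sum>k < stages m T. card (Tk m T k))"

definition stage :: "nat \<Rightarrow> nat set \<Rightarrow> nat \<Rightarrow> bit poly \<Rightarrow> bit poly" where
  "stage m T k Y = Y + (\<Sum>t\<in>Tk m T k. rshift m (2 ^ k * \<Delta> m t) Y)"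

text \<open>The input polynomial is \<open>L + monom 1 m * H\<close>.\<close>

definition frobenius_reduce :: "nat \<Rightarrow> nat set \<Rightarrow> bit poly \<Rightarrow> bit poly \<Rightarrow> bit poly" where
  "frobenius_reduce m T L H = L + V m T (fold (stage m T) [0..<stages m T] H)"


section \<open>Destination-word counts\<close>

definition ceil_div :: "nat \<Rightarrow> nat \<Rightarrow> nat" where
  "ceil_div a b = nat \<lceil>real a / real b\<rceil>"

definition words_meeting :: "nat \<Rightarrow> nat set \<Rightarrow> nat set" where
  "words_meeting W P = (\<lambda>i. i div W) ` P"

text \<open>Triples of a stage, an index of \<open>T\<close> whose shift is active at it, and a destination word.\<close>

definition Bhat_fb :: "nat \<Rightarrow> nat \<Rightarrow> nat set \<Rightarrow> nat" where
  "Bhat_fb W m T = card {(k, t, w). t \<in> T \<and> 2 ^ k * \<Delta> m t < m \<and>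
     w \<in> words_meeting W {..<m - 2 ^ k * \<Delta> m t}}"

definition stage_positions :: "nat \<Rightarrow> nat set \<Rightarrow> nat \<Rightarrow> nat set" where
  "stage_positions m T k = (\<Union>t\<in>Tk m T k. {..<m - 2 ^ k * \<Delta> m t})"

definition stage_range :: "nat \<Rightarrow> nat \<Rightarrow> nat set \<Rightarrow> nat \<Rightarrow> nat set" where
  "stage_range W m T k = {w. \<exists>v \<in> words_meeting W (stage_positions m T k). w \<le> v}"

definition visits :: "nat \<Rightarrow> nat \<Rightarrow> nat \<Rightarrow> nat \<Rightarrow> nat \<Rightarrow> bool" where
  "visits W m k t w \<longleftrightarrow> w + 2 ^ k * \<Delta> m t div W < ceil_div m W"

definition B_loop :: "nat \<Rightarrow> nat \<Rightarrow> nat set \<Rightarrow> nat" where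
  "B_loop W m T = card {(k, t, w). k < stages m T \<and> t \<in> Tk m T k \<and>
     w \<in> stage_range W m T k \<and> visits W m k t w}"

definition B_V :: "nat \<Rightarrow> nat \<Rightarrow> nat set \<Rightarrow> nat" where
  "B_V W m T = card {(t, w). t \<in> T \<and> w \<in> words_meeting W {t..<m}}"

definition a :: "nat \<Rightarrow> nat \<Rightarrow> nat set \<Rightarrow> nat \<Rightarrow> nat" where
  "a W m T k = ceil_div (m - 2 ^ k * \<Delta>min m T) W"


section \<open>The in-place packed scalar implementation\<close>

text \<open>
  \<open>packed m xs p\<close>: the word list \<open>xs\<close> stores the polynomial \<open>p\<close> of degree below \<open>m\<close>; since
  coefficients of \<open>p\<close> from position \<open>m\<close> on vanish, this includes the zero padding above.
\<close>

definition packed :: "nat \<Rightarrow> 'w::len word list \<Rightarrow> bit poly \<Rightarrow> bool" where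
  "packed m xs p \<longleftrightarrow> degree p < m \<and> length xs = ceil_div m LENGTH('w) \<and>
     (\<forall>i < length xs * LENGTH('w).
        bit (xs ! (i div LENGTH('w))) (i mod LENGTH('w)) \<longleftrightarrow> coeff p i = 1)"

definition get :: "'w::len word list \<Rightarrow> nat \<Rightarrow> 'w word" where
  "get xs i = (if i < length xs then xs ! i else 0)"

text \<open>
  Word \<open>w\<close> of a packed polynomial shifted right (left) by \<open>d\<close> positions, combined from two
  adjacent source words. If the width divides \<open>d\<close>, the second operand is shifted by the full
  width and vanishes.
\<close>

definition right_word :: "'w::len word list \<Rightarrow> nat \<Rightarrow> nat \<Rightarrow> 'w word" where
  "right_word xs d w = (let q = d div LENGTH('w); s = d mod LENGTH('w) in
     or (drop_bit s (get xs (w + q))) (push_bit (LENGTH('w) - s) (get xs (w + q + 1))))"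

definition left_word :: "'w::len word list \<Rightarrow> nat \<Rightarrow> nat \<Rightarrow> 'w word" where
  "left_word xs d w = (let q = d div LENGTH('w); s = d mod LENGTH('w) in
     or (if q \<le> w then push_bit s (get xs (w - q)) else 0)
        (if q + 1 \<le> w then drop_bit (LENGTH('w) - s) (get xs (w - q - 1)) else 0))"

text \<open>
  Each step is the traversal of one destination word; the list carried by a feedback or
  assembly step holds the indices whose shifted words are accumulated into that word.
\<close>

datatype step =
    Extract nat
  | Feedback nat nat "nat list"
  | Assemble nat "nat list"

text \<open>
  The state consists of the input array \<open>A\<close>, whose low words are finally overwritten by the
  result, and the high-part array \<open>Y\<close>, which the feedback stages update in place. Destination
  words are processed in increasing order and a right shift reads only words at or above its
  destination, so every shift of a stage reads the stage input. In the final assembly,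
  \<open>take_bit\<close> clears the positions from \<open>m\<close> on.
\<close>

fun exec :: "nat \<Rightarrow> step \<Rightarrow> 'w::len word list \<times> 'w word list \<Rightarrow> 'w word list \<times> 'w word list" where
  "exec m (Extract w) (A, Y) = (A, Y[w := right_word A m w])"
| "exec m (Feedback k w ts) (A, Y) =
     (A, Y[w := fold (\<lambda>t. xor (right_word Y (2 ^ k * \<Delta> m t) w)) ts (Y ! w)])"
| "exec m (Assemble w ts) (A, Y) =
     (A[w := take_bit (m - w * LENGTH('w))
               (fold (\<lambda>t. xor (left_word Y t w)) ts (A ! w))], Y)"

definition scalar_program :: "nat \<Rightarrow> nat \<Rightarrow> nat set \<Rightarrow> step list" where
  "scalar_program W m T =
     map Extract [0..<ceil_div m W] @
     concat (map (\<lambda>k. map (\<lambda>w. Feedback k w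
         (filter (\<lambda>t. visits W m k t w) (sorted_list_of_set (Tk m T k))))
       (sorted_list_of_set (stage_range W m T k))) [0..<stages m T]) @
     map (\<lambda>w. Assemble w
         (filter (\<lambda>t. w \<in> words_meeting W {t..<m}) (sorted_list_of_set T)))
       [0..<ceil_div m W]"

definition extracted_words :: "step list \<Rightarrow> nat list" where
  "extracted_words P = concat (map (\<lambda>c. case c of Extract w \<Rightarrow> [w] | _ \<Rightarrow> []) P)"

definition feedback_words :: "nat \<Rightarrow> step list \<Rightarrow> nat list" where
  "feedback_words k P =
     concat (map (\<lambda>c. case c of Feedback j w ts \<Rightarrow> (if j = k then [w] else []) | _ \<Rightarrow> []) P)"

definition assembled_words :: "step list \<Rightarrow> nat list" where
  "assembled_words P = concat (map (\<lambda>c. case c of Assemble w ts \<Rightarrow> [w] | _ \<Rightarrow> []) P)"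

definition shifted_contributions :: "step list \<Rightarrow> nat" where
  "shifted_contributions P = (\<Sum>c\<leftarrow>P. case c of
     Extract w \<Rightarrow> 0 | Feedback k w ts \<Rightarrow> length ts | Assemble w ts \<Rightarrow> length ts)"

end

theory Submission
  imports Defs
begin

text \<open>
  A shift by \<open>d\<close> usefully affects \<open>ceil((m - d)/W)\<close> words, while the source bound of the loop
  leaves \<open>n - floor(d/W)\<close> words; these two numbers differ by at most one, which gives the bounds
  on the loop count. The shift by \<open>2 ^ k * \<Delta>min m T\<close> alone accounts for all \<open>a W m T k\<close> words
  of stage \<open>k\<close>. For the correctness of the program, every array is read as a coefficient
  sequence: bit \<open>j\<close> of word \<open>w\<close> of a shifted array is the coefficient at \<open>w * W + j\<close> plus or
  minus the shift, words skipped by the loops contribute only zeros, and a right shift never reads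
  a word that an ascending in-place traversal has already overwritten.
\<close>

section \<open>Ceiling division and word ranges\<close>

text \<open>Counting words from \<open>0\<close>, word \<open>w\<close> is needed exactly when its
  first position \<open>w * b\<close> lies below \<open>x\<close>. All later reasoning about
  \<open>ceil_div\<close> rests on this equivalence, which replaces real ceilings by inequalities of
  natural numbers.\<close>

lemma less_ceil_div_iff: "b > 0 \<Longrightarrow> w < ceil_div x b \<longleftrightarrow> w * b < x"
  unfolding ceil_div_def
  by (simp add: zless_nat_eq_int_zless less_ceiling_iff pos_less_divide_eq flip: of_nat_mult)

lemma ceil_div_mono: "b > 0 \<Longrightarrow> x \<le> y \<Longrightarrow> ceil_div x b \<le> ceil_div y b"
  by (rule ccontr) (use less_ceil_div_iff[of b "ceil_div y b"] in \<open>force simp: not_le\<close>)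

text \<open>Rounding \<open>d\<close> down to whole words gives at most \<open>d\<close>, so a
  destination word starting below \<open>x - d\<close> has a source word starting below
  \<open>x\<close>. Hence the source bound never rejects a useful contribution.\<close>

lemma ceil_div_diff_le:
  assumes "b > 0"
  shows "ceil_div (x - d) b \<le> ceil_div x b - d div b"
proof (rule ccontr)
  define w where "w = ceil_div x b - d div b"
  assume "\<not> ?thesis"
  then have "w * b < x - d"
    using less_ceil_div_iff[OF assms, of w "x - d"] by (simp add: w_def)
  moreover have "d div b * b \<le> d" by simp
  ultimately have "(w + d div b) * b < x" unfolding add_mult_distrib by linarith
  then have "w + d div b < ceil_div x b" using less_ceil_div_iff[OF assms] by simp
  then show False by (simp add: w_def)
qed

lemma ceil_div_diff_ge:
  assumes "b > 0"
  shows "ceil_div x b - d div b \<le> ceil_div (x - d) b + 1"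
proof (rule ccontr)
  define w where "w = ceil_div (x - d) b"
  assume "\<not> ?thesis"
  then have "w + 1 + d div b < ceil_div x b" by (simp add: w_def)
  then have "w * b + (b + d div b * b) < x"
    using less_ceil_div_iff[OF assms] by (simp add: algebra_simps)
  moreover have "d < b + d div b * b"
    using assms by (metis dividend_less_div_times mult.commute)
  ultimately have "w * b < x - d" by linarith
  then show False using less_ceil_div_iff[OF assms, of w "x - d"] by (simp add: w_def)
qed

lemma words_meeting_lessThan: "W > 0 \<Longrightarrow> words_meeting W {..<x} = {..<ceil_div x W}"
proof (intro set_eqI iffI)
  fix w assume W: "W > 0" and "w \<in> words_meeting W {..<x}"
  then obtain i where "i < x" "w = i div W" by (auto simp: words_meeting_def)
  then have "w * W < x" using div_times_less_eq_dividend le_less_trans by blast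
  then show "w \<in> {..<ceil_div x W}" using less_ceil_div_iff[OF W] by simp
next
  fix w assume W: "W > 0" and "w \<in> {..<ceil_div x W}"
  then have "w * W < x" using less_ceil_div_iff[OF W] by simp
  then show "w \<in> words_meeting W {..<x}"
    using W by (auto simp: words_meeting_def intro!: image_eqI[of _ _ "w * W"])
qed

lemma words_meeting_atLeastLessThan:
  assumes W: "W > 0" and "t < x"
  shows "words_meeting W {t..<x} = {t div W..<ceil_div x W}"
proof (intro set_eqI iffI)
  fix w assume "w \<in> words_meeting W {t..<x}"
  then obtain i where i: "t \<le> i" "i < x" "w = i div W" by (auto simp: words_meeting_def)
  then have "w * W < x" using div_times_less_eq_dividend le_less_trans by blast
  then show "w \<in> {t div W..<ceil_div x W}"
    using less_ceil_div_iff[OF W] i by (simp add: div_le_mono)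
next
  fix w assume w: "w \<in> {t div W..<ceil_div x W}"
  then have wx: "w * W < x" using less_ceil_div_iff[OF W] by simp
  \<comment> \<open>The witness is the first position of the interval inside word \<open>w\<close>.
    It is the start of the word, except possibly in the first word \<open>t div W\<close>, where it
    may be \<open>t\<close>.\<close>
  have "max t (w * W) div W = w"
  proof (cases "t \<le> w * W")
    case False
    then have "w \<le> t div W" using W by (simp add: less_eq_div_iff_mult_less_eq)
    with w False show ?thesis by simp
  qed (use W in simp)
  then show "w \<in> words_meeting W {t..<x}"
    using wx \<open>t < x\<close> by (auto simp: words_meeting_def intro!: image_eqI[of _ _ "max t (w * W)"])
qed


section \<open>Stages and counts\<close>

lemma \<Delta>min_le: "finite T \<Longrightarrow> t \<in> T \<Longrightarrow> \<Delta>min m T \<le> \<Delta> m t"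
  by (simp add: \<Delta>min_def)

lemma \<Delta>min_mult_le: "finite T \<Longrightarrow> t \<in> T \<Longrightarrow> 2 ^ k * \<Delta>min m T \<le> 2 ^ k * \<Delta> m t"
  by (simp add: \<Delta>min_le)

lemma \<Delta>min_attained:
  assumes "finite T" "T \<noteq> {}"
  obtains t where "t \<in> T" "\<Delta> m t = \<Delta>min m T"
  using Min_in[of "\<Delta> m ` T"] assms unfolding \<Delta>min_def by fastforce

text \<open>A shift by \<open>m\<close> or more is an empty sum, so a nonzero \<open>U m T\<close>
  needs some index whose shift is shorter than \<open>m\<close>.\<close>

lemma \<Delta>min_less_if_U_nonzero:
  assumes "finite T" "U m T \<noteq> (\<lambda>_. 0)"
  shows "T \<noteq> {}" "\<Delta>min m T < m"
proof -
  have "\<exists>t\<in>T. \<Delta> m t < m"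
  proof (rule ccontr)
    assume "\<not> ?thesis"
    then have "rshift m (\<Delta> m t) y = 0" if "t \<in> T" for t y
      using that by (simp add: rshift_def not_less)
    then have "U m T = (\<lambda>_. 0)" by (simp add: U_def fun_eq_iff)
    then show False using assms by simp
  qed
  then obtain t where t: "t \<in> T" "\<Delta> m t < m" by blast
  show "T \<noteq> {}" using t(1) by blast
  show "\<Delta>min m T < m" by (rule le_less_trans[OF \<Delta>min_le[OF assms(1) t(1)] t(2)])
qed

text \<open>Being below a ceiling means being strictly below the logarithm itself, and
  exponentiating leaves an integer comparison. The stages are thus exactly those at which the
  shortest shift is still active.\<close>

lemma less_stages_iff:
  assumes "\<Delta>min m T > 0" "\<Delta>min m T < m"
  shows "k < stages m T \<longleftrightarrow> 2 ^ k * \<Delta>min m T < m"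
proof -
  have "k < stages m T \<longleftrightarrow> real k < log 2 (real m / real (\<Delta>min m T))"
    by (simp add: stages_def zless_nat_eq_int_zless less_ceiling_iff)
  also have "\<dots> \<longleftrightarrow> real (2 ^ k) < real m / real (\<Delta>min m T)"
    using assms by (subst less_log_iff) (simp_all add: powr_realpow)
  also have "\<dots> \<longleftrightarrow> real (2 ^ k * \<Delta>min m T) < real m"
    using assms by (simp add: pos_less_divide_eq)
  finally show ?thesis by (simp only: of_nat_less_iff)
qed

text \<open>The positions affected by the shifts are nested initial segments, so their union is the
  one of the shortest shift. If even that shift is inactive, both sides are empty.\<close>

lemma stage_range_eq:
  assumes W: "W > 0" and fin: "finite T" and ne: "T \<noteq> {}"
  shows "stage_range W m T k = {..<a W m T k}"
proof -
  have "stage_positions m T k = {..<m - 2 ^ k * \<Delta>min m T}"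
  proof (intro subset_antisym subsetI)
    fix i assume "i \<in> stage_positions m T k"
    then obtain t where t: "t \<in> T" "i < m - 2 ^ k * \<Delta> m t"
      by (auto simp: stage_positions_def Tk_def)
    show "i \<in> {..<m - 2 ^ k * \<Delta>min m T}"
      using less_le_trans[OF t(2) diff_le_mono2[OF \<Delta>min_mult_le[OF fin t(1)]]] by blast
  next
    fix i assume i: "i \<in> {..<m - 2 ^ k * \<Delta>min m T}"
    obtain t where t: "t \<in> T" "\<Delta> m t = \<Delta>min m T" using \<Delta>min_attained[OF fin ne] .
    then have "t \<in> Tk m T k" using i by (simp add: Tk_def)
    moreover have "i \<in> {..<m - 2 ^ k * \<Delta> m t}" using i by (simp only: t)
    ultimately show "i \<in> stage_positions m T k" unfolding stage_positions_def by blast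
  qed
  then have "words_meeting W (stage_positions m T k) = {..<a W m T k}"
    by (simp add: words_meeting_lessThan[OF W] a_def)
  then have "w \<in> stage_range W m T k \<longleftrightarrow> w < a W m T k" for w
    unfolding stage_range_def mem_Collect_eq
    by (simp only: Bex_def lessThan_iff) (blast intro: le_less_trans)
  then show ?thesis by blast
qed

section \<open>Closed forms of the word counts\<close>

lemma card_triples:
  assumes "finite I" "\<And>i. i \<in> I \<Longrightarrow> finite (J i)" "\<And>i j. i \<in> I \<Longrightarrow> j \<in> J i \<Longrightarrow> finite (K i j)"
  shows "card {(i, j, l). i \<in> I \<and> j \<in> J i \<and> l \<in> K i j} = (\<Sum>i\<in>I. \<Sum>j\<in>J i. card (K i j))"
proof -
  have "{(i, j, l). i \<in> I \<and> j \<in> J i \<and> l \<in> K i j} = (SIGMA i:I. SIGMA j:J i. K i j)" by auto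
  then show ?thesis using assms by simp
qed

text \<open>\<open>Bhat_fb\<close> puts no explicit bound on the stage; finiteness comes from the
  growth \<open>k < 2 ^ k\<close> together with \<open>d > 0\<close>.\<close>

lemma finite_active: "d > 0 \<Longrightarrow> finite {k. 2 ^ k * d < (m::nat)}"
proof (rule finite_subset)
  assume d: "d > 0"
  show "{k. 2 ^ k * d < m} \<subseteq> {..<m}"
  proof clarify
    fix k assume k: "2 ^ k * d < m"
    have "k < 2 ^ k" by (rule less_exp)
    also have "\<dots> \<le> 2 ^ k * d" using d by simp
    finally show "k < m" using k by simp
  qed
qed simp

lemma Bhat_fb_eq:
  assumes W: "W > 0" and T: "T \<subseteq> {..<m}"
  shows "Bhat_fb W m T =
    (\<Sum>t\<in>T. \<Sum>k | 2 ^ k * \<Delta> m t < m. ceil_div (m - 2 ^ k * \<Delta> m t) W)"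
proof -
  let ?K = "\<lambda>t k. {..<ceil_div (m - 2 ^ k * \<Delta> m t) W}"
  \<comment> \<open>The components are reordered because the closed form sums over \<open>t\<close>
    first, with the range of \<open>k\<close> depending on \<open>t\<close>.\<close>
  let ?S = "{(t, k, w). t \<in> T \<and> k \<in> {k. 2 ^ k * \<Delta> m t < m} \<and> w \<in> ?K t k}"
  have "{(k, t, w). t \<in> T \<and> 2 ^ k * \<Delta> m t < m \<and> w \<in> words_meeting W {..<m - 2 ^ k * \<Delta> m t}}
      = (\<lambda>(t, k, w). (k, t, w)) ` ?S"
    by (auto simp: words_meeting_lessThan[OF W] image_iff)
  moreover have "inj_on (\<lambda>(t, k, w). (k, t, w)) ?S" by (auto simp: inj_on_def)
  ultimately have "Bhat_fb W m T = card ?S" by (simp add: Bhat_fb_def card_image)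
  also have "\<dots> = (\<Sum>t\<in>T. \<Sum>k | 2 ^ k * \<Delta> m t < m. card (?K t k))"
    using T by (intro card_triples finite_active) (auto simp: \<Delta>_def intro: finite_subset)
  finally show ?thesis by simp
qed

lemma B_V_eq:
  assumes W: "W > 0" and T: "T \<subseteq> {..<m}"
  shows "B_V W m T = (\<Sum>t\<in>T. ceil_div m W - t div W)"
proof -
  have "{(t, w). t \<in> T \<and> w \<in> words_meeting W {t..<m}} = (SIGMA t:T. {t div W..<ceil_div m W})"
    using T by (auto simp: words_meeting_atLeastLessThan[OF W])
  moreover have "finite T" using T by (rule finite_subset) simp
  ultimately show ?thesis by (simp add: B_V_def)
qed

text \<open>Both the contiguous range of the stage and the source bound cut out an initial segment
  of words, and the shorter one decides.\<close>

lemma B_loop_eq: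
  assumes W: "W > 0" and fin: "finite T" and ne: "T \<noteq> {}"
  shows "B_loop W m T = (\<Sum>k < stages m T. \<Sum>t\<in>Tk m T k.
    min (a W m T k) (ceil_div m W - 2 ^ k * \<Delta> m t div W))"
proof -
  let ?K = "\<lambda>k t. {..<min (a W m T k) (ceil_div m W - 2 ^ k * \<Delta> m t div W)}"
  have "{(k, t, w). k < stages m T \<and> t \<in> Tk m T k \<and> w \<in> stage_range W m T k \<and> visits W m k t w}
      = {(k, t, w). k \<in> {..<stages m T} \<and> t \<in> Tk m T k \<and> w \<in> ?K k t}"
    by (auto simp: stage_range_eq[OF assms] visits_def)
  moreover have "card \<dots> = (\<Sum>k < stages m T. \<Sum>t\<in>Tk m T k. card (?K k t))"
    using fin by (intro card_triples) (auto simp: Tk_def)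
  ultimately show ?thesis by (simp add: B_loop_def)
qed

section \<open>Comparison of useful and traversed contributions\<close>

lemma Bhat_fb_eq_stages:
  assumes W: "W > 0" and T: "T \<subseteq> {..<m}" and fin: "finite T"
    and \<Delta>: "\<Delta>min m T > 0" "\<Delta>min m T < m"
  shows "Bhat_fb W m T =
    (\<Sum>k < stages m T. \<Sum>t\<in>Tk m T k. ceil_div (m - 2 ^ k * \<Delta> m t) W)"
proof -
  \<comment> \<open>No shift is shorter than the minimal one, so no pair is active from stage
    \<open>stages m T\<close> on. This bounds the range of \<open>k\<close> independently of
    \<open>t\<close> and allows the two sums to be swapped.\<close>
  have "k < stages m T" if "t \<in> T" "2 ^ k * \<Delta> m t < m" for k t
    unfolding less_stages_iff[OF \<Delta>]
    by (rule le_less_trans[OF \<Delta>min_mult_le[OF fin that(1)] that(2)])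
  then have "{k. 2 ^ k * \<Delta> m t < m} = {k\<in>{..<stages m T}. 2 ^ k * \<Delta> m t < m}" if "t \<in> T" for t
    using that by auto
  then have "Bhat_fb W m T = (\<Sum>t\<in>T. \<Sum>k | k \<in> {..<stages m T} \<and> 2 ^ k * \<Delta> m t < m.
      ceil_div (m - 2 ^ k * \<Delta> m t) W)"
    unfolding Bhat_fb_eq[OF W T] by (intro sum.cong) auto
  also have "\<dots> = (\<Sum>k < stages m T. \<Sum>t\<in>Tk m T k. ceil_div (m - 2 ^ k * \<Delta> m t) W)"
    unfolding Tk_def by (rule sum.swap_restrict) (simp_all add: fin)
  finally show ?thesis .
qed

text \<open>The lower bound has to be checked against both arguments of the minimum: monotonicity
  handles \<open>a W m T k\<close>, rounding handles the source bound. The upper bound needs the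
  source bound only.\<close>

lemma contribution_bounds:
  fixes m k :: nat
  assumes W: "W > 0" and fin: "finite T" and t: "t \<in> T"
  defines "c \<equiv> ceil_div (m - 2 ^ k * \<Delta> m t) W"
  defines "l \<equiv> min (a W m T k) (ceil_div m W - 2 ^ k * \<Delta> m t div W)"
  shows "c \<le> l" "l \<le> c + 1"
proof -
  have "c \<le> a W m T k"
    unfolding a_def c_def by (intro ceil_div_mono[OF W] diff_le_mono2 \<Delta>min_mult_le[OF fin t])
  then show "c \<le> l" "l \<le> c + 1"
    using ceil_div_diff_le[OF W] ceil_div_diff_ge[OF W] by (auto simp: c_def l_def min_le_iff_disj)
qed

lemma Bhat_fb_le_B_loop:
  assumes W: "W > 0" and T: "T \<subseteq> {..<m}" and fin: "finite T" and ne: "T \<noteq> {}"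
    and \<Delta>: "\<Delta>min m T > 0" "\<Delta>min m T < m"
  shows "Bhat_fb W m T \<le> B_loop W m T"
  unfolding Bhat_fb_eq_stages[OF W T fin \<Delta>] B_loop_eq[OF W fin ne]
  by (intro sum_mono contribution_bounds[OF W fin]) (simp add: Tk_def)

lemma B_loop_le_Bhat_fb_plus_S_fb:
  assumes W: "W > 0" and T: "T \<subseteq> {..<m}" and fin: "finite T" and ne: "T \<noteq> {}"
    and \<Delta>: "\<Delta>min m T > 0" "\<Delta>min m T < m"
  shows "B_loop W m T \<le> Bhat_fb W m T + S_fb m T"
proof -
  have "B_loop W m T \<le> (\<Sum>k < stages m T. \<Sum>t\<in>Tk m T k. ceil_div (m - 2 ^ k * \<Delta> m t) W + 1)"
    unfolding B_loop_eq[OF W fin ne]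
    by (intro sum_mono contribution_bounds[OF W fin]) (simp add: Tk_def)
  \<comment> \<open>The excess of one per active pair sums to the cardinalities of the sets
    \<open>Tk m T k\<close>, which is \<open>S_fb m T\<close>.\<close>
  then show ?thesis
    unfolding Bhat_fb_eq_stages[OF W T fin \<Delta>] S_fb_def by (simp add: sum.distrib sum_Suc)
qed

lemma sum_a_le_B_loop:
  assumes W: "W > 0" and fin: "finite T" and ne: "T \<noteq> {}"
    and \<Delta>: "\<Delta>min m T > 0" "\<Delta>min m T < m"
  shows "(\<Sum>k < stages m T. a W m T k) \<le> B_loop W m T"
  unfolding B_loop_eq[OF W fin ne]
proof (rule sum_mono)
  fix k assume "k \<in> {..<stages m T}"
  then have k: "2 ^ k * \<Delta>min m T < m" by (simp add: less_stages_iff[OF \<Delta>])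
  let ?l = "\<lambda>t. min (a W m T k) (ceil_div m W - 2 ^ k * \<Delta> m t div W)"
  obtain t where t: "t \<in> T" "\<Delta> m t = \<Delta>min m T" using \<Delta>min_attained[OF fin ne] .
  have "a W m T k = ceil_div (m - 2 ^ k * \<Delta> m t) W" by (simp add: t a_def)
  \<comment> \<open>For an index attaining the minimum, the useful support is all of
    \<open>a W m T k\<close>, so this single summand suffices.\<close>
  also have "\<dots> \<le> ?l t" by (rule contribution_bounds[OF W fin t(1)])
  also have "\<dots> \<le> (\<Sum>t\<in>Tk m T k. ?l t)"
    using t k fin by (intro member_le_sum) (simp_all add: Tk_def)
  finally show "a W m T k \<le> (\<Sum>t\<in>Tk m T k. ?l t)" .
qed


section \<open>The shape of the program\<close>

lemma sorted_list_of_stage_range: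
  assumes "W > 0" "finite T" "T \<noteq> {}"
  shows "sorted_list_of_set (stage_range W m T k) = [0..<a W m T k]"
  unfolding stage_range_eq[OF assms] lessThan_atLeast0 by (rule sorted_list_of_set_range)

lemma sum_list_sorted_list_of_set:
  "finite S \<Longrightarrow> (\<Sum>x\<leftarrow>sorted_list_of_set S. f x) = (\<Sum>x\<in>S. f x)"
  using sum.distinct_set_conv_list[of "sorted_list_of_set S" f] by simp

lemma sum_list_upt: "(\<Sum>x\<leftarrow>[0..<b]. f x) = (\<Sum>x<b. f x)"
  by (induction b) (simp_all add: add.commute)

lemma length_filter_eq_sum_list: "length (filter Q xs) = (\<Sum>x\<leftarrow>xs. of_bool (Q x))"
  by (induction xs) simp_all

lemma extracted_words_program:
  "extracted_words (scalar_program W m T) = [0..<ceil_div m W]"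
  by (simp add: extracted_words_def scalar_program_def map_concat o_def)

lemma assembled_words_program:
  "assembled_words (scalar_program W m T) = [0..<ceil_div m W]"
  by (simp add: assembled_words_def scalar_program_def map_concat o_def)

lemma feedback_words_append: "feedback_words k (P @ Q) = feedback_words k P @ feedback_words k Q"
  by (simp add: feedback_words_def)

lemma feedback_words_concat:
  "feedback_words k (concat Ps) = concat (map (feedback_words k) Ps)"
  by (induction Ps) (simp_all add: feedback_words_append, simp add: feedback_words_def)

lemma feedback_words_Feedback:
  "feedback_words k (map (\<lambda>w. Feedback j w (f w)) ws) = (if j = k then ws else [])"
  by (induction ws) (simp_all add: feedback_words_def)

lemma concat_map_single:
  "k < r \<Longrightarrow> concat (map (\<lambda>j. if j = k then f j else []) [0..<r]) = f k"
proof (induction r)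
  case (Suc r)
  show ?case
  proof (cases "k = r")
    case True
    then have "concat (map (\<lambda>j. if j = k then f j else []) [0..<r]) = []" by simp
    with True show ?thesis by simp
  qed (use Suc in simp)
qed simp

lemma feedback_words_program:
  assumes "W > 0" "finite T" "T \<noteq> {}" and k: "k < stages m T"
  shows "feedback_words k (scalar_program W m T) = [0..<a W m T k]"
proof -
  have "feedback_words k (map Extract ws) = []" "feedback_words k (map (\<lambda>w. Assemble w (f w)) ws) = []"
    for ws f by (simp_all add: feedback_words_def o_def)
  then show ?thesis
    by (simp add: scalar_program_def feedback_words_append feedback_words_concat o_def
        feedback_words_Feedback concat_map_single[OF k] sorted_list_of_stage_range[OF assms(1-3)])
qed

lemma length_program:
  assumes "W > 0" "finite T" "T \<noteq> {}"
  shows "length (scalar_program W m T)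
    = ceil_div m W + (\<Sum>k < stages m T. a W m T k) + ceil_div m W"
  by (simp add: scalar_program_def length_concat o_def sorted_list_of_stage_range[OF assms]
      sum_list_upt)

section \<open>Counting the shifted contributions of the program\<close>

lemma shifted_contributions_append:
  "shifted_contributions (P @ Q) = shifted_contributions P + shifted_contributions Q"
  by (simp add: shifted_contributions_def)

lemma shifted_contributions_concat:
  "shifted_contributions (concat Ps) = (\<Sum>P\<leftarrow>Ps. shifted_contributions P)"
  by (induction Ps) (simp_all add: shifted_contributions_append, simp add: shifted_contributions_def)

text \<open>Double counting: the program lists the shifts for each destination word, whereas the
  closed forms count the destination words for each shift.\<close>

lemma sum_length_filter:
  assumes "finite S"
  shows "(\<Sum>w\<leftarrow>[0..<b]. length (filter (Q w) (sorted_list_of_set S)))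
    = (\<Sum>t\<in>S. card {w. w < b \<and> Q w t})"
proof -
  have "(\<Sum>w\<leftarrow>[0..<b]. length (filter (Q w) (sorted_list_of_set S)))
      = (\<Sum>w<b. \<Sum>t\<in>S. of_bool (Q w t))"
    by (simp add: length_filter_eq_sum_list sum_list_sorted_list_of_set[OF assms] sum_list_upt)
  also have "\<dots> = (\<Sum>t\<in>S. \<Sum>w<b. of_bool (Q w t))" by (rule sum.swap)
  also have "\<dots> = (\<Sum>t\<in>S. card {w. w < b \<and> Q w t})"
    by (simp add: sum_of_bool_eq lessThan_def Collect_conj_eq)
  finally show ?thesis .
qed

lemma shifted_contributions_program:
  assumes W: "W > 0" and T: "T \<subseteq> {..<m}" and fin: "finite T" and ne: "T \<noteq> {}"
  shows "shifted_contributions (scalar_program W m T) = B_loop W m T + B_V W m T"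
proof -
  let ?n = "ceil_div m W"
  have ext: "shifted_contributions (map Extract ws) = 0" for ws
    by (simp add: shifted_contributions_def o_def)
  have feedback: "shifted_contributions (map (\<lambda>w. Feedback k w
        (filter (\<lambda>t. visits W m k t w) (sorted_list_of_set (Tk m T k))))
        (sorted_list_of_set (stage_range W m T k)))
      = (\<Sum>t\<in>Tk m T k. min (a W m T k) (?n - 2 ^ k * \<Delta> m t div W))" for k
  proof -
    have "{w. w < a W m T k \<and> visits W m k t w}
        = {..<min (a W m T k) (?n - 2 ^ k * \<Delta> m t div W)}" for t
      by (auto simp: visits_def)
    then show ?thesis
      using fin by (simp add: shifted_contributions_def o_def sum_length_filter Tk_def
          sorted_list_of_stage_range[OF W fin ne])
  qed
  have assemble: "shifted_contributions (map (\<lambda>w. Assemble w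
        (filter (\<lambda>t. w \<in> words_meeting W {t..<m}) (sorted_list_of_set T))) [0..<?n])
      = (\<Sum>t\<in>T. ?n - t div W)"
  proof -
    have "{w. w < ?n \<and> w \<in> words_meeting W {t..<m}} = {t div W..<?n}" if "t \<in> T" for t
      using T that by (auto simp: words_meeting_atLeastLessThan[OF W])
    then show ?thesis
      using fin by (simp add: shifted_contributions_def o_def sum_length_filter)
  qed
  show ?thesis
    by (simp add: scalar_program_def shifted_contributions_append shifted_contributions_concat
        ext feedback assemble o_def B_loop_eq[OF W fin ne] B_V_eq[OF W T]
        sum_list_upt)
qed


section \<open>Packed polynomials\<close>

text \<open>An array is read as an infinite coefficient sequence: \<open>get\<close> supplies zero
  words past the end, so shifted indices need no bounds.\<close>

definition coef :: "'w::len word list \<Rightarrow> nat \<Rightarrow> bit" where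
  "coef xs i = of_bool (bit (get xs (i div LENGTH('w))) (i mod LENGTH('w)))"

lemma of_bool_eq_bit_iff: "of_bool P = (x :: bit) \<longleftrightarrow> (P \<longleftrightarrow> x = 1)"
  by (cases x) auto

lemma coef_word:
  fixes xs :: "'w::len word list"
  assumes "j < LENGTH('w)"
  shows "coef xs (w * LENGTH('w) + j) = of_bool (bit (get xs w) j)"
  using assms by (simp add: coef_def)

lemma coef_eq_0:
  fixes xs :: "'w::len word list"
  assumes "length xs * LENGTH('w) \<le> i"
  shows "coef xs i = 0"
proof -
  have "length xs \<le> i div LENGTH('w)" using assms by (simp add: less_eq_div_iff_mult_less_eq)
  then show ?thesis by (simp add: coef_def get_def)
qed

section \<open>Bits of words shifted across word boundaries\<close>

lemma bit_right_word:
  fixes xs :: "'w::len word list"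
  assumes j: "j < LENGTH('w)"
  shows "of_bool (bit (right_word xs d w) j) = coef xs (w * LENGTH('w) + j + d)"
proof -
  define q s where "q = d div LENGTH('w)" and "s = d mod LENGTH('w)"
  have s: "s < LENGTH('w)" by (simp add: s_def)
  have d: "d = q * LENGTH('w) + s" by (simp add: q_def s_def)
  \<comment> \<open>With \<open>d\<close> split into whole words and a remainder, the wanted bit
    lies in word \<open>w + q\<close>, or in the next word if \<open>j + s\<close> overflows the
    width.\<close>
  have i: "w * LENGTH('w) + j + d = (w + q) * LENGTH('w) + (j + s)"
    by (simp add: d algebra_simps)
  show ?thesis
  proof (cases "j + s < LENGTH('w)")
    case True
    \<comment> \<open>Here the operand pushed up from the next word has a zero at bit
      \<open>j\<close>.\<close>
    then have "\<not> LENGTH('w) - s \<le> j" by linarith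
    then show ?thesis
      unfolding i coef_word[OF True]
      using j by (simp add: right_word_def Let_def bit_simps add.commute flip: q_def s_def)
  next
    case False
    define l where "l = j + s - LENGTH('w)"
    have l: "l < LENGTH('w)" and l': "j + s = LENGTH('w) + l" using False s j by (simp_all add: l_def)
    have i': "(w + q) * LENGTH('w) + (j + s) = (w + q + 1) * LENGTH('w) + l"
      by (simp add: l')
    have "LENGTH('w) - s \<le> j" "j - (LENGTH('w) - s) = l" using False s by (simp_all add: l_def)
    \<comment> \<open>Here the operand from word \<open>w + q\<close> is read beyond its width and
      gives zero.\<close>
    moreover have "\<not> bit (get xs (w + q)) (s + j)" using False by (auto dest: bit_imp_le_length)
    ultimately show ?thesis
      unfolding i i' coef_word[OF l] using j s False
      by (simp add: right_word_def Let_def bit_simps flip: q_def s_def)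
  qed
qed

lemma bit_left_word:
  fixes xs :: "'w::len word list"
  assumes j: "j < LENGTH('w)"
  shows "of_bool (bit (left_word xs d w) j)
    = (if d \<le> w * LENGTH('w) + j then coef xs (w * LENGTH('w) + j - d) else 0)"
proof -
  define q s where "q = d div LENGTH('w)" and "s = d mod LENGTH('w)"
  have s: "s < LENGTH('w)" by (simp add: s_def)
  have d: "d = q * LENGTH('w) + s" by (simp add: q_def s_def)
  have lw: "left_word xs d w = or (if q \<le> w then push_bit s (get xs (w - q)) else 0)
        (if q + 1 \<le> w then drop_bit (LENGTH('w) - s) (get xs (w - q - 1)) else 0)"
    by (simp add: left_word_def Let_def q_def s_def)
  \<comment> \<open>In the first and third cases the position lies below \<open>d\<close> and the
    bit is zero. In the second it comes from word \<open>w - q\<close>, in the fourth from word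
    \<open>w - q - 1\<close>.\<close>
  consider "w < q" | u where "w = q + u" "s \<le> j" | "w = q" "j < s"
    | u where "w = q + 1 + u" "j < s"
    by (metis Suc_eq_plus1 add.assoc add.commute less_iff_Suc_add linorder_not_less
        le_Suc_ex linorder_less_linear)
  then show ?thesis
  proof cases
    case 1
    then have "(w + 1) * LENGTH('w) \<le> q * LENGTH('w)" by (intro mult_le_mono1) simp
    then have "\<not> d \<le> w * LENGTH('w) + j" using j by (simp add: d)
    with 1 show ?thesis by (simp add: lw)
  next
    case 2
    have "w * LENGTH('w) + j = d + (u * LENGTH('w) + (j - s))" (is "_ = d + ?v")
      using 2 by (simp add: d algebra_simps)
    then have le: "d \<le> w * LENGTH('w) + j"
      and diff: "w * LENGTH('w) + j - d = ?v" by (simp_all only: le_add1 add_diff_cancel_left')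
    have "j - s < LENGTH('w)" using j by simp
    note c = coef_word[OF this, of xs u]
    \<comment> \<open>Since \<open>s \<le> j\<close>, the dropped neighbour would be read beyond its
      width, so only the pushed operand counts.\<close>
    have "\<not> bit (get xs (u - 1)) (LENGTH('w) - s + j)"
      using 2 s by (auto dest: bit_imp_le_length)
    then show ?thesis unfolding lw diff c using le 2 j by (simp add: bit_simps)
  next
    case 3
    then show ?thesis unfolding lw by (simp add: d bit_simps)
  next
    case 4
    have "w * LENGTH('w) + j = d + (u * LENGTH('w) + (LENGTH('w) - s + j))" (is "_ = d + ?v")
      using 4 s by (simp add: d algebra_simps)
    then have le: "d \<le> w * LENGTH('w) + j"
      and diff: "w * LENGTH('w) + j - d = ?v" by (simp_all only: le_add1 add_diff_cancel_left')
    have "LENGTH('w) - s + j < LENGTH('w)" using 4 s by simp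
    note c = coef_word[OF this, of xs u]
    show ?thesis unfolding lw diff c using le 4 j by (simp add: bit_simps)
  qed
qed

text \<open>A right shift reads only words at or above its destination; this is what makes the
  feedback stages safe in place.\<close>

lemma right_word_cong:
  assumes "length xs = length ys" "\<And>i. w \<le> i \<Longrightarrow> i < length ys \<Longrightarrow> xs ! i = ys ! i"
  shows "right_word xs d w = right_word ys d w"
  using assms by (simp add: right_word_def Let_def get_def)

text \<open>Exclusive or is addition in the two-element field, so accumulated words become sums of
  coefficients.\<close>

lemma bit_fold_xor:
  "of_bool (bit (fold (\<lambda>t. xor (f t)) ts x) j)
    = (of_bool (bit x j) + (\<Sum>t\<leftarrow>ts. of_bool (bit (f t) j)) :: bit)"
  by (induction ts arbitrary: x) (auto simp: bit_xor_iff of_bool_def ac_simps)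

lemma packed_coef:
  fixes xs :: "'w::len word list"
  assumes "packed m xs p"
  shows "coef xs i = coeff p i"
proof (cases "i < length xs * LENGTH('w)")
  case True
  then have "i div LENGTH('w) < length xs" by (simp add: less_mult_imp_div_less)
  with True assms show ?thesis by (simp add: packed_def coef_def get_def of_bool_eq_bit_iff)
next
  case False
  \<comment> \<open>The array covers at least \<open>m\<close> positions, so anything past its end
    is also past the degree.\<close>
  have "\<not> length xs * LENGTH('w) < m"
    using assms less_ceil_div_iff[of "LENGTH('w)" "length xs" m] by (simp add: packed_def)
  with False assms have "degree p < i" by (simp add: packed_def)
  with False show ?thesis by (simp add: coef_eq_0 coeff_eq_0)
qed

lemma packedI:
  fixes xs :: "'w::len word list"
  assumes "degree p < m" and len: "length xs = ceil_div m LENGTH('w)"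
    and bits: "\<And>w j. w < length xs \<Longrightarrow> j < LENGTH('w) \<Longrightarrow>
      of_bool (bit (xs ! w) j) = coeff p (w * LENGTH('w) + j)"
  shows "packed m xs p"
  unfolding packed_def
proof (intro conjI allI impI)
  fix i assume "i < length xs * LENGTH('w)"
  then have "i div LENGTH('w) < length xs" by (simp add: less_mult_imp_div_less)
  from bits[OF this, of "i mod LENGTH('w)"]
  show "bit (xs ! (i div LENGTH('w))) (i mod LENGTH('w)) \<longleftrightarrow> coeff p i = 1"
    by (simp add: of_bool_eq_bit_iff)
qed (use assms in auto)

lemma packed_bit:
  fixes xs :: "'w::len word list"
  assumes "packed m xs p" "w < length xs" "j < LENGTH('w)"
  shows "of_bool (bit (xs ! w) j) = coeff p (w * LENGTH('w) + j)"
  using packed_coef[OF assms(1)] coef_word[OF assms(3), of xs w] assms(2) by (simp add: get_def)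


section \<open>Coefficients of the polynomial operations\<close>

text \<open>The cut at \<open>m - d\<close> is automatic: from there on the source position
  \<open>i + d\<close> is at least \<open>m\<close>, where \<open>y\<close> has no
  coefficients.\<close>

lemma coeff_rshift:
  assumes "degree y < m"
  shows "coeff (rshift m d y) i = coeff y (i + d)"
proof (cases "i < m - d")
  case False
  then have "degree y < i + d" using assms by linarith
  with False show ?thesis by (simp add: rshift_def coeff_sum coeff_eq_0)
qed (simp add: rshift_def coeff_sum)

lemma coeff_stage:
  assumes "degree p < m"
  shows "coeff (stage m T k p) i = coeff p i + (\<Sum>t\<in>Tk m T k. coeff p (i + 2 ^ k * \<Delta> m t))"
  by (simp add: stage_def coeff_sum coeff_rshift[OF assms])

lemma degree_stage:
  assumes "degree p < m"
  shows "degree (stage m T k p) < m"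
  using assms by (intro degree_lessI) (auto simp: coeff_stage coeff_eq_0)

lemma coeff_mod_monom:
  fixes p :: "'a::field poly"
  shows "coeff (p mod monom 1 m) i = (if i < m then coeff p i else 0)"
proof (cases "i < m")
  case True
  have "coeff p i = coeff (monom 1 m * (p div monom 1 m) + p mod monom 1 m) i" by simp
  also have "\<dots> = coeff (p mod monom 1 m) i"
    using True unfolding coeff_add coeff_monom_mult by simp
  finally show ?thesis using True by simp
next
  case False
  then show ?thesis
    using degree_mod_less[of "monom 1 m" p] by (auto simp: degree_monom_eq coeff_eq_0)
qed

lemma coeff_V:
  "coeff (V m T q) i = (if i < m then \<Sum>t\<in>T. if t \<le> i then coeff q (i - t) else 0 else 0)"
  by (auto simp: V_def coeff_sum coeff_mod_monom coeff_monom_mult not_less intro!: sum.cong)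


section \<open>Execution\<close>

text \<open>An ascending in-place traversal equals a simultaneous update when the new word
  \<open>w\<close> depends only on words from \<open>w\<close> on: these still hold their original
  contents when \<open>w\<close> is reached.\<close>

lemma fold_list_update:
  assumes "\<And>zs w. length zs = length ys \<Longrightarrow> w < length ys \<Longrightarrow>
    (\<And>i. w \<le> i \<Longrightarrow> i < length ys \<Longrightarrow> zs ! i = ys ! i) \<Longrightarrow> F zs w = F ys w"
  shows "fold (\<lambda>w zs. zs[w := F zs w]) [0..<b] ys
    = map (\<lambda>i. if i < b then F ys i else ys ! i) [0..<length ys]"
proof (induction b)
  case 0
  show ?case by (simp add: map_nth)
next
  case (Suc b)
  let ?zs = "map (\<lambda>i. if i < b then F ys i else ys ! i) [0..<length ys]"
  \<comment> \<open>For \<open>b\<close> past the end the list update has no effect, so only indices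
    inside the array need the comparison.\<close>
  have "F ?zs b = F ys b" if "b < length ys" using that by (intro assms) simp_all
  then show ?case
    using Suc by (auto intro!: nth_equalityI simp: nth_list_update less_Suc_eq)
qed

lemma fold_exec_Extract:
  "fold (exec m) (map Extract ws) (A, Y) = (A, fold (\<lambda>w Y. Y[w := right_word A m w]) ws Y)"
  by (induction ws arbitrary: Y) simp_all

lemma fold_exec_Feedback:
  "fold (exec m) (map (\<lambda>w. Feedback k w (f w)) ws) (A, Y) = (A, fold (\<lambda>w Y. Y[w :=
    fold (\<lambda>t. xor (right_word Y (2 ^ k * \<Delta> m t) w)) (f w) (Y ! w)]) ws Y)"
  by (induction ws arbitrary: Y) simp_all

lemma fold_exec_Assemble:
  fixes A Y :: "'w::len word list"
  shows "fold (exec m) (map (\<lambda>w. Assemble w (f w)) ws) (A, Y) = (fold (\<lambda>w A. A[w :=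
    take_bit (m - w * LENGTH('w)) (fold (\<lambda>t. xor (left_word Y t w)) (f w) (A ! w))]) ws A, Y)"
  by (induction ws arbitrary: A) simp_all

section \<open>Correctness of extraction, feedback and assembly\<close>

lemma packed_Extract:
  fixes m :: nat and A Y :: "'w::len word list"
  defines "n \<equiv> ceil_div m LENGTH('w)"
  assumes A: "packed l A (L + monom 1 m * H)" and deg: "degree L < m" "degree H < m"
    and Y: "length Y = n"
  obtains Y' where "fold (exec m) (map Extract [0..<n]) (A, Y) = (A, Y')" "packed m Y' H"
proof
  let ?Y' = "map (right_word A m) [0..<n]"
  have "fold (\<lambda>w Y. Y[w := right_word A m w]) [0..<n] Y = ?Y'"
    by (subst fold_list_update) (simp_all add: Y)
  then show "fold (exec m) (map Extract [0..<n]) (A, Y) = (A, ?Y')"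
    by (simp only: fold_exec_Extract)
  show "packed m ?Y' H"
  proof (rule packedI)
    fix w j assume "w < length ?Y'" "j < LENGTH('w)"
    \<comment> \<open>\<open>L\<close> ends below position \<open>m\<close>, so shifting the input
      right by \<open>m\<close> leaves exactly \<open>H\<close>.\<close>
    moreover have "coeff (L + monom 1 m * H) (i + m) = coeff H i" for i
      using deg(1) by (simp add: coeff_monom_mult coeff_eq_0)
    ultimately show "of_bool (bit (?Y' ! w) j) = coeff H (w * LENGTH('w) + j)"
      by (simp add: bit_right_word packed_coef[OF A])
  qed (simp_all add: deg n_def)
qed

text \<open>Besides the in-place order, two savings need justification: sources rejected by
  \<open>visits\<close> and destination words beyond \<open>a W m T k\<close> would contribute only
  zeros.\<close>

lemma packed_Feedback:
  fixes A Y :: "'w::len word list"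
  defines "W \<equiv> LENGTH('w)"
  assumes Y: "packed m Y p" and fin: "finite T" and ne: "T \<noteq> {}"
  obtains Y' where "fold (exec m) (map (\<lambda>w. Feedback k w
      (filter (\<lambda>t. visits W m k t w) (sorted_list_of_set (Tk m T k))))
      (sorted_list_of_set (stage_range W m T k))) (A, Y) = (A, Y')"
    "packed m Y' (stage m T k p)"
proof
  have W: "W > 0" by (simp add: W_def)
  have len: "length Y = ceil_div m W" and deg: "degree p < m" using Y by (simp_all add: packed_def W_def)
  have finTk: "finite (Tk m T k)" using fin by (simp add: Tk_def)
  let ?ts = "\<lambda>w. filter (\<lambda>t. visits W m k t w) (sorted_list_of_set (Tk m T k))"
  let ?F = "\<lambda>Y w. fold (\<lambda>t. xor (right_word Y (2 ^ k * \<Delta> m t) w)) (?ts w) (Y ! w)"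
  let ?Y' = "map (\<lambda>w. if w < a W m T k then ?F Y w else Y ! w) [0..<length Y]"
  have F_cong: "?F Z w = ?F Y w" if "length Z = length Y" "w < length Y"
    "\<And>i. w \<le> i \<Longrightarrow> i < length Y \<Longrightarrow> Z ! i = Y ! i" for Z w
    using that right_word_cong[of Z Y w] by simp
  have "fold (\<lambda>w Y. Y[w := ?F Y w]) [0..<a W m T k] Y = ?Y'"
    by (rule fold_list_update[where F = ?F]) (rule F_cong)
  then show "fold (exec m) (map (\<lambda>w. Feedback k w (?ts w))
      (sorted_list_of_set (stage_range W m T k))) (A, Y) = (A, ?Y')"
    by (simp only: sorted_list_of_stage_range[OF W fin ne] fold_exec_Feedback)
  show "packed m ?Y' (stage m T k p)"
  proof (rule packedI)
    fix w j assume "w < length ?Y'" and j: "j < LENGTH('w)"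
    then have w: "w < length Y" by simp
    let ?i = "w * W + j"
    show "of_bool (bit (?Y' ! w) j) = coeff (stage m T k p) (w * LENGTH('w) + j)"
    proof (cases "w < a W m T k")
      case True
      \<comment> \<open>A rejected source word lies past the end of the array, and adding the offset
        \<open>j\<close> can only move the position further up.\<close>
      have skipped: "coeff p (?i + 2 ^ k * \<Delta> m t) = 0" if "\<not> visits W m k t w" for t
      proof -
        have "length Y \<le> w + 2 ^ k * \<Delta> m t div W" using that by (simp add: visits_def len)
        also have "\<dots> = (w * W + 2 ^ k * \<Delta> m t) div W" using W by simp
        also have "\<dots> \<le> (?i + 2 ^ k * \<Delta> m t) div W" by (intro div_le_mono) simp
        finally have "length Y * W \<le> ?i + 2 ^ k * \<Delta> m t"
          using W by (simp add: less_eq_div_iff_mult_less_eq)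
        then show ?thesis using coef_eq_0[of Y] packed_coef[OF Y] by (simp add: W_def)
      qed
      have "of_bool (bit (?Y' ! w) j) = coeff p ?i + (\<Sum>t\<leftarrow>?ts w. coeff p (?i + 2 ^ k * \<Delta> m t))"
        using True w j
        by (simp add: bit_fold_xor packed_bit[OF Y] bit_right_word packed_coef[OF Y] W_def)
      also have "(\<Sum>t\<leftarrow>?ts w. coeff p (?i + 2 ^ k * \<Delta> m t))
          = (\<Sum>t\<in>Tk m T k. coeff p (?i + 2 ^ k * \<Delta> m t))"
        by (subst sum_list_map_filter) (simp_all add: skipped sum_list_sorted_list_of_set finTk)
      finally show ?thesis by (simp add: coeff_stage[OF deg] W_def)
    next
      case False
      \<comment> \<open>In an untraversed word even the shortest shift leads to a position at or
        above \<open>m\<close>, so the stage leaves these coefficients unchanged.\<close>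
      have "coeff p (?i + 2 ^ k * \<Delta> m t) = 0" if "t \<in> Tk m T k" for t
      proof (rule coeff_eq_0)
        have "m - 2 ^ k * \<Delta>min m T \<le> w * W"
          using False less_ceil_div_iff[OF W] by (simp add: a_def not_less)
        then have "m \<le> w * W + 2 ^ k * \<Delta>min m T" by simp
        also have "\<dots> \<le> ?i + 2 ^ k * \<Delta> m t"
          using that by (intro add_mono \<Delta>min_mult_le[OF fin]) (simp_all add: Tk_def)
        finally show "degree p < ?i + 2 ^ k * \<Delta> m t" using deg by simp
      qed
      then show ?thesis
        using False w j by (simp add: coeff_stage[OF deg] packed_bit[OF Y] W_def)
    qed
  qed (simp_all add: degree_stage deg len W_def)
qed

lemma packed_Feedback_stages:
  fixes A Y :: "'w::len word list"
  defines "W \<equiv> LENGTH('w)"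
  assumes Y: "packed m Y p" and fin: "finite T" and ne: "T \<noteq> {}"
  shows "\<exists>Y'. fold (exec m) (concat (map (\<lambda>k. map (\<lambda>w. Feedback k w
        (filter (\<lambda>t. visits W m k t w) (sorted_list_of_set (Tk m T k))))
        (sorted_list_of_set (stage_range W m T k))) [0..<r])) (A, Y) = (A, Y') \<and>
      packed m Y' (fold (stage m T) [0..<r] p)"
proof (induction r)
  case 0
  show ?case using Y by simp
next
  case (Suc r)
  then obtain Y' where Y': "packed m Y' (fold (stage m T) [0..<r] p)"
    "fold (exec m) (concat (map (\<lambda>k. map (\<lambda>w. Feedback k w
        (filter (\<lambda>t. visits W m k t w) (sorted_list_of_set (Tk m T k))))
        (sorted_list_of_set (stage_range W m T k))) [0..<r])) (A, Y) = (A, Y')"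
    by blast
  from packed_Feedback[OF Y'(1) fin ne, of r A, folded W_def] obtain Y'' where
    "fold (exec m) (map (\<lambda>w. Feedback r w
        (filter (\<lambda>t. visits W m r t w) (sorted_list_of_set (Tk m T r))))
        (sorted_list_of_set (stage_range W m T r))) (A, Y') = (A, Y'')"
    "packed m Y'' (stage m T r (fold (stage m T) [0..<r] p))" .
  with Y' show ?case by simp
qed

lemma packed_Assemble:
  fixes m :: nat and T :: "nat set" and A Y :: "'w::len word list"
  defines "W \<equiv> LENGTH('w)"
  defines "n \<equiv> ceil_div m W"
  assumes A: "packed l A (L + monom 1 m * H)" and "m \<le> l" and deg: "degree L < m"
    and Y: "packed m Y q" and fin: "finite T" and T: "T \<subseteq> {..<m}"
  shows "packed m (take n (fst (fold (exec m) (map (\<lambda>w. Assemble w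
      (filter (\<lambda>t. w \<in> words_meeting W {t..<m}) (sorted_list_of_set T))) [0..<n]) (A, Y))))
    (L + V m T q)"
proof -
  have W: "W > 0" by (simp add: W_def)
  have n: "n \<le> length A"
    using A ceil_div_mono[OF W \<open>m \<le> l\<close>] by (simp add: packed_def n_def W_def)
  let ?ts = "\<lambda>w. filter (\<lambda>t. w \<in> words_meeting W {t..<m}) (sorted_list_of_set T)"
  let ?F = "\<lambda>A w. take_bit (m - w * W) (fold (\<lambda>t. xor (left_word Y t w)) (?ts w) (A ! w))"
  let ?A' = "map (\<lambda>w. if w < n then ?F A w else A ! w) [0..<length A]"
  have F_cong: "?F Z w = ?F A w" if "length Z = length A" "w < length A"
    "\<And>i. w \<le> i \<Longrightarrow> i < length A \<Longrightarrow> Z ! i = A ! i" for Z w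
    using that by simp
  have "fold (\<lambda>w A. A[w := ?F A w]) [0..<n] A = ?A'"
    by (rule fold_list_update[where F = ?F]) (rule F_cong)
  then have "fst (fold (exec m) (map (\<lambda>w. Assemble w (?ts w)) [0..<n]) (A, Y)) = ?A'"
    by (simp only: fold_exec_Assemble W_def fst_conv)
  moreover have "packed m (take n ?A') (L + V m T q)"
  proof (rule packedI)
    show "degree (L + V m T q) < m"
      using deg by (intro degree_lessI) (auto simp: coeff_V coeff_eq_0)
    show "length (take n ?A') = ceil_div m LENGTH('w)" using n by (simp add: n_def W_def)
  next
    fix w j assume "w < length (take n ?A')" and j: "j < LENGTH('w)"
    then have w: "w < n" "w < length A" by simp_all
    let ?i = "w * W + j"
    \<comment> \<open>\<open>take_bit\<close> keeps bit \<open>j\<close> of word \<open>w\<close>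
      exactly when its position is below \<open>m\<close>; this matters in the last word, where the
      input may also hold bits of \<open>H\<close>.\<close>
    have iff: "j < m - w * W \<longleftrightarrow> ?i < m" by linarith
    show "of_bool (bit (take n ?A' ! w) j) = coeff (L + V m T q) (w * LENGTH('w) + j)"
    proof (cases "?i < m")
      case True
      let ?c = "\<lambda>t. if t \<le> ?i then coeff q (?i - t) else 0"
      \<comment> \<open>An omitted word lies entirely below position \<open>t\<close>, where the
        left shift by \<open>t\<close> has only zeros.\<close>
      have skipped: "?c t = 0" if "t \<in> T" "w \<notin> words_meeting W {t..<m}" for t
      proof -
        have "w < t div W"
          using that T w by (auto simp: words_meeting_atLeastLessThan[OF W] n_def)
        then have "(w + 1) * W \<le> t div W * W" by (intro mult_le_mono1) simp
        also have "\<dots> \<le> t" by simp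
        finally show ?thesis using j by (simp add: W_def)
      qed
      have bit_eq: "bit (take n ?A' ! w) j
          \<longleftrightarrow> bit (fold (\<lambda>t. xor (left_word Y t w)) (?ts w) (A ! w)) j"
        using True w iff by (simp add: bit_take_bit_iff)
      have "of_bool (bit (take n ?A' ! w) j) = coeff (L + monom 1 m * H) ?i + (\<Sum>t\<leftarrow>?ts w. ?c t)"
        unfolding bit_eq bit_fold_xor packed_bit[OF A w(2) j] bit_left_word[OF j] packed_coef[OF Y]
        by (simp only: W_def)
      also have "(\<Sum>t\<leftarrow>?ts w. ?c t) = (\<Sum>t\<in>T. ?c t)"
        by (subst sum_list_map_filter) (use skipped fin in \<open>simp_all add: sum_list_sorted_list_of_set\<close>)
      \<comment> \<open>Below position \<open>m\<close> the input array holds only \<open>L\<close>,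
        since the multiple of \<open>monom 1 m\<close> starts at \<open>m\<close>.\<close>
      finally show ?thesis using True by (simp add: coeff_V coeff_monom_mult flip: W_def)
    next
      case False
      have "\<not> bit (take n ?A' ! w) j" using False w iff by (simp add: bit_take_bit_iff)
      then show ?thesis using False deg by (simp add: coeff_V coeff_eq_0 flip: W_def)
    qed
  qed
  ultimately show ?thesis by simp
qed

lemma packed_scalar_program:
  fixes A Y :: "'w::len word list"
  defines "W \<equiv> LENGTH('w)"
  assumes T: "T \<subseteq> {..<m}" and ne: "T \<noteq> {}" and deg: "degree L < m" "degree H < m"
    and A: "packed (2 * m) A (L + monom 1 m * H)" and Y: "length Y = ceil_div m W"
  shows "packed m (take (ceil_div m W) (fst (fold (exec m) (scalar_program W m T) (A, Y))))
    (frobenius_reduce m T L H)"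
proof -
  have fin: "finite T" using T by (rule finite_subset) simp
  from packed_Extract[OF A deg Y[unfolded W_def], folded W_def] obtain Y1 where Y1:
    "fold (exec m) (map Extract [0..<ceil_div m W]) (A, Y) = (A, Y1)" "packed m Y1 H" .
  from packed_Feedback_stages[OF Y1(2) fin ne, of "stages m T" A, folded W_def]
  obtain Y2 where Y2: "fold (exec m) (concat (map (\<lambda>k. map (\<lambda>w. Feedback k w
        (filter (\<lambda>t. visits W m k t w) (sorted_list_of_set (Tk m T k))))
        (sorted_list_of_set (stage_range W m T k))) [0..<stages m T])) (A, Y1) = (A, Y2)"
      "packed m Y2 (fold (stage m T) [0..<stages m T] H)" by blast
  from packed_Assemble[OF A _ deg(1) Y2(2) fin T, folded W_def] show ?thesis
    by (simp add: scalar_program_def Y1(1) Y2(1) frobenius_reduce_def)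
qed

theorem proposition5p3:
  fixes m W n :: nat and T :: "nat set" and P :: "step list"
  assumes "m \<ge> 1" and "T \<subseteq> {..<m}"
    and "W = LENGTH('w::len)" and "n = ceil_div m W"
    and "P = scalar_program W m T"
  shows "Bhat_fb W m T =
           (\<Sum>t\<in>T. \<Sum>k | 2 ^ k * \<Delta> m t < m. ceil_div (m - 2 ^ k * \<Delta> m t) W) \<and>
         B_V W m T = (\<Sum>t\<in>T. n - t div W) \<and>
         (U m T \<noteq> (\<lambda>_. 0) \<longrightarrow>
           B_loop W m T =
             (\<Sum>k < stages m T. \<Sum>t\<in>Tk m T k.
                min (a W m T k) (n - 2 ^ k * \<Delta> m t div W)) \<and>
           Bhat_fb W m T \<le> B_loop W m T \<and>
           B_loop W m T \<le> Bhat_fb W m T + S_fb m T \<and>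
           (\<Sum>k < stages m T. a W m T k) \<le> B_loop W m T \<and>
           extracted_words P = [0..<n] \<and>
           (\<forall>k < stages m T. feedback_words k P = [0..<a W m T k]) \<and>
           assembled_words P = [0..<n] \<and>
           length P = n + (\<Sum>k < stages m T. a W m T k) + n \<and>
           shifted_contributions P = B_loop W m T + B_V W m T \<and>
           (\<forall>L H (A :: 'w word list) Y.
              degree L < m \<longrightarrow> degree H < m \<longrightarrow>
              packed (2 * m) A (L + monom 1 m * H) \<longrightarrow> length Y = n \<longrightarrow>
              packed m (take n (fst (fold (exec m) P (A, Y)))) (frobenius_reduce m T L H)))"
proof -
  have W: "W > 0" by (simp add: assms(3))
  have fin: "finite T" using assms(2) by (rule finite_subset) simp
  show ?thesis
  proof (intro conjI impI)
    show "Bhat_fb W m T =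
        (\<Sum>t\<in>T. \<Sum>k | 2 ^ k * \<Delta> m t < m. ceil_div (m - 2 ^ k * \<Delta> m t) W)"
      by (rule Bhat_fb_eq[OF W assms(2)])
    show "B_V W m T = (\<Sum>t\<in>T. n - t div W)"
      unfolding assms(4) by (rule B_V_eq[OF W assms(2)])
  next
    assume "U m T \<noteq> (\<lambda>_. 0)"
    then have ne: "T \<noteq> {}" and less: "\<Delta>min m T < m"
      using \<Delta>min_less_if_U_nonzero[OF fin] by auto
    obtain t where "t \<in> T" "\<Delta> m t = \<Delta>min m T" using \<Delta>min_attained[OF fin ne] .
    \<comment> \<open>Every index is below \<open>m\<close>, so all shifts are positive and the
      quotient defining \<open>stages\<close> has a nonzero denominator.\<close>
    then have pos: "\<Delta>min m T > 0" using assms(2) by (auto simp: \<Delta>_def)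
    note WT = W assms(2) fin ne
    show "B_loop W m T = (\<Sum>k < stages m T. \<Sum>t\<in>Tk m T k.
        min (a W m T k) (n - 2 ^ k * \<Delta> m t div W))"
      unfolding assms(4) by (rule B_loop_eq[OF W fin ne])
    show "Bhat_fb W m T \<le> B_loop W m T" by (rule Bhat_fb_le_B_loop[OF WT pos less])
    show "B_loop W m T \<le> Bhat_fb W m T + S_fb m T"
      by (rule B_loop_le_Bhat_fb_plus_S_fb[OF WT pos less])
    show "(\<Sum>k < stages m T. a W m T k) \<le> B_loop W m T"
      by (rule sum_a_le_B_loop[OF W fin ne pos less])
    show "extracted_words P = [0..<n]" "assembled_words P = [0..<n]"
      by (simp_all add: assms(4,5) extracted_words_program assembled_words_program)
    show "\<forall>k < stages m T. feedback_words k P = [0..<a W m T k]"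
      by (simp add: assms(5) feedback_words_program[OF W fin ne])
    show "length P = n + (\<Sum>k < stages m T. a W m T k) + n"
      by (simp add: assms(4,5) length_program[OF W fin ne])
    show "shifted_contributions P = B_loop W m T + B_V W m T"
      by (simp add: assms(5) shifted_contributions_program[OF WT])
    show "\<forall>L H (A :: 'w word list) Y.
        degree L < m \<longrightarrow> degree H < m \<longrightarrow>
        packed (2 * m) A (L + monom 1 m * H) \<longrightarrow> length Y = n \<longrightarrow>
        packed m (take n (fst (fold (exec m) P (A, Y)))) (frobenius_reduce m T L H)"
      unfolding assms(3-5) using packed_scalar_program[OF assms(2) ne] by blast
  qed
qed
end
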